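(* Let $K$ be a field, let $k\ge 2$ be an integer, and let $a,d\in\mathbb{N}^2$ be linearly independent over $\mathbb{Q}$ such that $\{a,a+d,\ldots,a+kd\}$ is a minimal generating set of $S_{a,d,k}=\langle a,a+d,\ldots,a+kd\rangle$. Then the set $G=\bigcup_{\ell=2}^{k}\xi_\ell$ is a minimal generating set of the defining ideal $I_{S_{a,d,k}}\subseteq K[x_1,\ldots,x_{k+1}]$ of $K[S_{a,d,k}]$, where for $\ell\in\{2,\ldots,k\}$ the set $\xi_\ell$ is defined as follows. If $2\ell>k+1$, then $$\xi_\ell=\{x_\ell^2-x_{2\ell-k-1}x_{k+1}\}\cup\{x_\ell x_{\ell+i}-x_{2\ell-k-1+i}x_{k+1}\mid 1\le i\le k-\ell\}.$$ If $2\ell\le k+1$, then $$\xi_\ell=\{x_\ell^2-x_1x_{2\ell-1}\}\cup\{x_\ell x_{\ell+i}-x_1x_{2\ell-1+i}\mid 1\le i\le k-2\ell+2\}\cup\{x_\ell x_{\ell+i}-x_{2\ell-k-1+i}x_{k+1}\mid k-2\ell+2<i\le k-\ell\}.$$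
   Context: $\mathbb{N}$ denotes the set of non-negative integers. $\langle a_1,\ldots,a_n\rangle=\{\sum_i\lambda_i a_i\mid \lambda_i\in\mathbb{N}\}$ is the affine semigroup generated by $a_1,\ldots,a_n\in\mathbb{N}^r$. $K[S]=\bigoplus_{s\in S}K\mathbf{t}^s\subseteq K[t_1,\ldots,t_r]$ is the semigroup ring of $S$. The defining ideal $I_{S_{a,d,k}}$ is the kernel of the $K$-algebra homomorphism $K[x_1,\ldots,x_{k+1}]\to K[S_{a,d,k}]$, $x_i\mapsto\mathbf{t}^{a+(i-1)d}$ for $i=1,\ldots,k+1$. *)

theory Defs
  imports
    "HOL-Analysis.Analysis"
    "HOL-Algebra.Ideal"
    "HOL-Algebra.RingHom"
    "HOL-Library.Poly_Mapping"
begin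

definition minimal_generating_set :: "('a set \<Rightarrow> 'a set) \<Rightarrow> 'a set \<Rightarrow> 'a set \<Rightarrow> bool" where
  "minimal_generating_set gen Y G \<longleftrightarrow>
     G \<subseteq> Y \<and> gen G = Y \<and> (\<forall>H. H \<subset> G \<longrightarrow> gen H \<noteq> Y)"


subsection \<open>Affine semigroups\<close>

text \<open>The generating set is meant to be finite; \<open>*s\<close> is the componentwise
  multiplication of a vector by a natural number.\<close>

definition affine_semigroup :: "(nat ^ 'r) set \<Rightarrow> (nat ^ 'r) set" where
  "affine_semigroup A = {\<Sum>v\<in>A. c v *s v | c. True}"

definition progression :: "nat ^ 'r \<Rightarrow> nat ^ 'r \<Rightarrow> nat \<Rightarrow> (nat ^ 'r) set" where
  "progression a d k = (\<lambda>i. a + i *s d) ` {0..k}"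

definition S_adk :: "nat ^ 'r \<Rightarrow> nat ^ 'r \<Rightarrow> nat \<Rightarrow> (nat ^ 'r) set" where
  "S_adk a d k = affine_semigroup (progression a d k)"

definition rat_vec :: "nat ^ 'r \<Rightarrow> rat ^ 'r" where
  "rat_vec v = (\<chi> i. of_nat (v $ i))"

text \<open>Linear independence of the two-element family \<open>(a, d)\<close>. As
  \<^const>\<open>vec.independent\<close> is a property of sets, \<open>a \<noteq> d\<close> has to be required separately.\<close>

definition lin_indep_rat :: "nat ^ 'r \<Rightarrow> nat ^ 'r \<Rightarrow> bool" where
  "lin_indep_rat a d \<longleftrightarrow> a \<noteq> d \<and> vec.independent {rat_vec a, rat_vec d}"


subsection \<open>Semigroup rings and polynomial rings\<close>

text \<open>A finitely supported function \<open>p :: 'm \<Rightarrow>\<^sub>0 'k\<close> stands for the sum of the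
  \<open>lookup p m \<cdot> t\<^sup>m\<close>; the multiplication on this type is convolution.
  For a submonoid \<open>S\<close> of \<open>'m\<close> the ring \<open>K[S]\<close> consists of the elements
  supported on \<open>S\<close>.\<close>

definition semigroup_ring :: "'m::comm_monoid_add set \<Rightarrow> ('m \<Rightarrow>\<^sub>0 'k::field) ring" where
  "semigroup_ring S =
     \<lparr>carrier = {p. Poly_Mapping.keys p \<subseteq> S}, mult = (*), one = 1, zero = 0, add = (+)\<rparr>"

type_synonym 'k mpoly = "(nat \<Rightarrow>\<^sub>0 nat) \<Rightarrow>\<^sub>0 'k"

text \<open>\<open>K[x\<^sub>1, \<dots>, x\<^sub>n]\<close>: the exponents are the finitely supported functions with
  support in \<open>{1..n}\<close>.\<close>

definition poly_ring :: "nat \<Rightarrow> 'k::field mpoly ring" where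
  "poly_ring n = semigroup_ring {m. Poly_Mapping.keys m \<subseteq> {1..n}}"

definition x_var :: "nat \<Rightarrow> 'k::field mpoly" where
  "x_var i = Poly_Mapping.single (Poly_Mapping.single i 1) 1"

definition const_poly :: "'k::field \<Rightarrow> 'm::comm_monoid_add \<Rightarrow>\<^sub>0 'k" where
  "const_poly c = Poly_Mapping.single 0 c"

text \<open>The \<open>K\<close>-algebra homomorphism with \<open>x\<^sub>i \<mapsto> f i\<close>.\<close>

definition subst_hom :: "(nat \<Rightarrow> ('m::comm_monoid_add \<Rightarrow>\<^sub>0 'k::field)) \<Rightarrow> 'k mpoly \<Rightarrow> ('m \<Rightarrow>\<^sub>0 'k)" where
  "subst_hom f p =
     (\<Sum>m\<in>Poly_Mapping.keys p. const_poly (Poly_Mapping.lookup p m) *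
        (\<Prod>i\<in>Poly_Mapping.keys m. f i ^ Poly_Mapping.lookup m i))"

definition phi :: "nat ^ 'r \<Rightarrow> nat ^ 'r \<Rightarrow> 'k::field mpoly \<Rightarrow> (nat ^ 'r \<Rightarrow>\<^sub>0 'k)" where
  "phi a d = subst_hom (\<lambda>i. Poly_Mapping.single (a + (i - 1) *s d) 1)"

definition defining_ideal :: "nat ^ 'r \<Rightarrow> nat ^ 'r \<Rightarrow> nat \<Rightarrow> 'k::field mpoly set" where
  "defining_ideal a d k = a_kernel (poly_ring (k + 1)) (semigroup_ring (S_adk a d k)) (phi a d)"


subsection \<open>The sets \<open>\<xi>\<^sub>\<ell>\<close>\<close>

text \<open>Wherever an index is a difference of natural numbers, it is positive under the
  conditions stated.\<close>

definition xi :: "nat \<Rightarrow> nat \<Rightarrow> 'k::field mpoly set" where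
  "xi k l =
     (if 2 * l > k + 1 then
        {x_var l ^ 2 - x_var (2 * l - (k + 1)) * x_var (k + 1)} \<union>
        {x_var l * x_var (l + i) - x_var (2 * l + i - (k + 1)) * x_var (k + 1) | i. 1 \<le> i \<and> i \<le> k - l}
      else
        {x_var l ^ 2 - x_var 1 * x_var (2 * l - 1)} \<union>
        {x_var l * x_var (l + i) - x_var 1 * x_var (2 * l - 1 + i) | i. 1 \<le> i \<and> i \<le> k + 2 - 2 * l} \<union>
        {x_var l * x_var (l + i) - x_var (2 * l + i - (k + 1)) * x_var (k + 1) | i.
           k + 2 - 2 * l < i \<and> i \<le> k - l})"


subsection \<open>Basic properties\<close>

lemma mult_closed_keys:
  fixes p q :: "'m::comm_monoid_add \<Rightarrow>\<^sub>0 'k::field"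
  assumes "\<And>x y. x \<in> S \<Longrightarrow> y \<in> S \<Longrightarrow> x + y \<in> S"
    and "Poly_Mapping.keys p \<subseteq> S" "Poly_Mapping.keys q \<subseteq> S"
  shows "Poly_Mapping.keys (p * q) \<subseteq> S"
  using keys_mult[of p q] assms by fastforce

lemma cring_semigroup_ring:
  assumes 0: "0 \<in> S" and add: "\<And>x y. x \<in> S \<Longrightarrow> y \<in> S \<Longrightarrow> x + y \<in> S"
  shows "cring (semigroup_ring S :: ('m::comm_monoid_add \<Rightarrow>\<^sub>0 'k::field) ring)"
proof (rule cringI)
  show "abelian_group (semigroup_ring S :: ('m \<Rightarrow>\<^sub>0 'k) ring)"
  proof (rule abelian_groupI)
    fix p :: "'m \<Rightarrow>\<^sub>0 'k"
    assume "p \<in> carrier (semigroup_ring S)"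
    then have "- p \<in> carrier (semigroup_ring S)"
      by (auto simp: semigroup_ring_def)
    then show "\<exists>q\<in>carrier (semigroup_ring S). q \<oplus>\<^bsub>semigroup_ring S\<^esub> p = \<zero>\<^bsub>semigroup_ring S\<^esub>"
      by (intro bexI[of _ "- p"]) (auto simp: semigroup_ring_def)
  next
    fix p q :: "'m \<Rightarrow>\<^sub>0 'k"
    assume "p \<in> carrier (semigroup_ring S)" "q \<in> carrier (semigroup_ring S)"
    then show "p \<oplus>\<^bsub>semigroup_ring S\<^esub> q \<in> carrier (semigroup_ring S)"
      using Poly_Mapping.keys_add[of p q] by (auto simp: semigroup_ring_def)
  qed (auto simp: semigroup_ring_def add_ac)
  show "comm_monoid (semigroup_ring S :: ('m \<Rightarrow>\<^sub>0 'k) ring)"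
    by (rule comm_monoidI)
      (use 0 in \<open>auto simp: semigroup_ring_def mult_ac dest: mult_closed_keys[OF add, THEN subsetD, rotated 2]\<close>)
qed (auto simp: semigroup_ring_def distrib_right)

lemma cring_poly_ring: "cring (poly_ring n :: 'k::field mpoly ring)"
  unfolding poly_ring_def
proof (rule cring_semigroup_ring)
  fix x y :: "nat \<Rightarrow>\<^sub>0 nat"
  assume "x \<in> {m. Poly_Mapping.keys m \<subseteq> {1..n}}" "y \<in> {m. Poly_Mapping.keys m \<subseteq> {1..n}}"
  then show "x + y \<in> {m. Poly_Mapping.keys m \<subseteq> {1..n}}"
    using Poly_Mapping.keys_add[of x y] by blast
qed simp

lemma zero_in_affine_semigroup: "0 \<in> affine_semigroup A"
  unfolding affine_semigroup_def
  by (rule CollectI, rule exI[of _ "\<lambda>_. 0"]) (simp add: vec_eq_iff)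

lemma add_in_affine_semigroup:
  assumes "x \<in> affine_semigroup A" "y \<in> affine_semigroup A"
  shows "x + y \<in> affine_semigroup A"
proof -
  obtain c c' where "x = (\<Sum>v\<in>A. c v *s v)" "y = (\<Sum>v\<in>A. c' v *s v)"
    using assms by (auto simp: affine_semigroup_def)
  then have "x + y = (\<Sum>v\<in>A. (c v + c' v) *s v)"
    by (simp add: sum.distrib[symmetric] vec_eq_iff distrib_right)
  then show ?thesis
    unfolding affine_semigroup_def by (intro CollectI exI[of _ "\<lambda>v. c v + c' v"] conjI TrueI)
qed

lemma generator_in_affine_semigroup:
  assumes "finite A" "v \<in> A"
  shows "v \<in> affine_semigroup A"
proof -
  have "(\<Sum>w\<in>A. (if w = v then 1 else 0) *s w) = (\<Sum>w\<in>A. if w = v then w else 0)"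
    by (intro sum.cong) (auto simp: vec_eq_iff)
  then have "v = (\<Sum>w\<in>A. (if w = v then 1 else 0) *s w)"
    using assms by simp
  then show ?thesis
    unfolding affine_semigroup_def by (intro CollectI exI[of _ "\<lambda>w. if w = v then 1 else 0"]) simp
qed

lemma cring_semigroup_ring_S_adk:
  "cring (semigroup_ring (S_adk a d k) :: (nat ^ 'r \<Rightarrow>\<^sub>0 'k::field) ring)"
  unfolding S_adk_def
  by (rule cring_semigroup_ring) (auto intro: zero_in_affine_semigroup add_in_affine_semigroup)

lemma subst_hom_superset:
  assumes "finite A" "Poly_Mapping.keys p \<subseteq> A"
  shows "subst_hom f p = (\<Sum>m\<in>A. const_poly (Poly_Mapping.lookup p m) *
    (\<Prod>i\<in>Poly_Mapping.keys m. f i ^ Poly_Mapping.lookup m i))"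
  unfolding subst_hom_def
  using assms by (intro sum.mono_neutral_left) (auto simp: const_poly_def in_keys_iff)

lemma subst_hom_add: "subst_hom f (p + q) = subst_hom f p + subst_hom f q"
proof -
  let ?A = "Poly_Mapping.keys p \<union> Poly_Mapping.keys q"
  have fin: "finite ?A" by simp
  have "Poly_Mapping.keys (p + q) \<subseteq> ?A"
    by (rule Poly_Mapping.keys_add)
  then show ?thesis
    using subst_hom_superset[OF fin, of p f] subst_hom_superset[OF fin, of q f]
      subst_hom_superset[OF fin, of "p + q" f]
    by (simp add: const_poly_def lookup_add single_add distrib_right sum.distrib)
qed

lemma subst_hom_zero [simp]: "subst_hom f 0 = 0"
  by (simp add: subst_hom_def)

lemma subst_hom_sum: "subst_hom f (sum g A) = (\<Sum>x\<in>A. subst_hom f (g x))"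
  by (induction A rule: infinite_finite_induct) (auto simp: subst_hom_add)

lemma subst_hom_single:
  "subst_hom f (Poly_Mapping.single m c) =
     const_poly c * (\<Prod>i\<in>Poly_Mapping.keys m. f i ^ Poly_Mapping.lookup m i)"
  by (subst subst_hom_superset[of "{m}"]) auto

lemma subst_hom_X: "subst_hom f (x_var i) = f i"
  by (simp add: x_var_def subst_hom_single const_poly_def)

lemma subst_hom_const: "subst_hom f (const_poly c) = const_poly c"
  by (subst const_poly_def) (simp add: subst_hom_single)

lemma subst_hom_one [simp]: "subst_hom f 1 = 1"
  using subst_hom_const[of f 1] by (simp add: const_poly_def)

lemma const_poly_mult: "const_poly (c * c') = const_poly c * const_poly c'"
  by (simp add: const_poly_def mult_single)

lemma sum_monomials:
  "(\<Sum>m\<in>Poly_Mapping.keys p. Poly_Mapping.single m (Poly_Mapping.lookup p m)) = p"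
  by (rule poly_mapping_eqI) (auto simp: lookup_sum lookup_single when_def in_keys_iff)

lemma monomial_value_add:
  fixes f :: "nat \<Rightarrow> 'a::comm_monoid_mult"
  shows "(\<Prod>i\<in>Poly_Mapping.keys (m + m'). f i ^ Poly_Mapping.lookup (m + m') i) =
    (\<Prod>i\<in>Poly_Mapping.keys m. f i ^ Poly_Mapping.lookup m i) *
    (\<Prod>i\<in>Poly_Mapping.keys m'. f i ^ Poly_Mapping.lookup m' i)"
proof -
  let ?A = "Poly_Mapping.keys m \<union> Poly_Mapping.keys m'"
  have *: "(\<Prod>i\<in>Poly_Mapping.keys n. f i ^ Poly_Mapping.lookup n i) =
      (\<Prod>i\<in>?A. f i ^ Poly_Mapping.lookup n i)" if "Poly_Mapping.keys n \<subseteq> ?A" for n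
    using that by (intro prod.mono_neutral_left) (auto simp: in_keys_iff)
  show ?thesis
    unfolding *[OF Poly_Mapping.keys_add] *[OF Un_upper1] *[OF Un_upper2]
    by (simp add: lookup_add power_add prod.distrib)
qed

lemma subst_hom_mult: "subst_hom f (p * q) = subst_hom f p * subst_hom f q"
proof -
  let ?mon = "\<lambda>r m. Poly_Mapping.single m (Poly_Mapping.lookup r m)"
  let ?P = "Poly_Mapping.keys p" and ?Q = "Poly_Mapping.keys q"
  have "subst_hom f (p * q) = subst_hom f ((\<Sum>m\<in>?P. ?mon p m) * (\<Sum>m\<in>?Q. ?mon q m))"
    by (simp add: sum_monomials)
  also have "\<dots> = (\<Sum>m\<in>?P. \<Sum>m'\<in>?Q. subst_hom f (?mon p m) * subst_hom f (?mon q m'))"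
    unfolding sum_product subst_hom_sum
    by (simp add: mult_single subst_hom_single monomial_value_add const_poly_mult mult_ac)
  also have "\<dots> = subst_hom f p * subst_hom f q"
    unfolding sum_product[symmetric] subst_hom_sum[symmetric] sum_monomials ..
  finally show ?thesis .
qed

lemma phi_X: "phi a d (x_var i) = Poly_Mapping.single (a + (i - 1) *s d) 1"
  by (simp add: phi_def subst_hom_X)

lemma phi_in_ring_hom:
  fixes a d :: "nat ^ 'r"
  shows "(phi a d :: 'k::field mpoly \<Rightarrow> _) \<in>
     ring_hom (poly_ring (k + 1)) (semigroup_ring (S_adk a d k))"
proof (rule ring_hom_memI)
  interpret S: cring "semigroup_ring (S_adk a d k) :: (nat ^ 'r \<Rightarrow>\<^sub>0 'k) ring"
    by (rule cring_semigroup_ring_S_adk)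
  let ?T = "semigroup_ring (S_adk a d k) :: (nat ^ 'r \<Rightarrow>\<^sub>0 'k) ring"
  have pow: "x ^ n \<in> carrier ?T" if "x \<in> carrier ?T" for x and n :: nat
    using that S.one_closed S.m_closed by (induction n) (auto simp: semigroup_ring_def)
  have prod: "prod h A \<in> carrier ?T" if "\<And>i. i \<in> A \<Longrightarrow> h i \<in> carrier ?T" for h and A :: "nat set"
    using that S.one_closed S.m_closed
    by (induction A rule: infinite_finite_induct) (auto simp: semigroup_ring_def)
  have sum: "sum h A \<in> carrier ?T" if "\<And>i. i \<in> A \<Longrightarrow> h i \<in> carrier ?T" for h and A :: "(nat \<Rightarrow>\<^sub>0 nat) set"
    using that S.zero_closed S.a_closed
    by (induction A rule: infinite_finite_induct) (auto simp: semigroup_ring_def)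
  have const: "const_poly c \<in> carrier ?T" for c
    by (auto simp: semigroup_ring_def const_poly_def S_adk_def zero_in_affine_semigroup)
  have gen: "Poly_Mapping.single (a + (i - 1) *s d) 1 \<in> carrier ?T" if "i \<in> {1..k + 1}" for i
  proof -
    have "a + (i - 1) *s d \<in> progression a d k"
      using that by (auto simp: progression_def)
    then have "a + (i - 1) *s d \<in> S_adk a d k"
      unfolding S_adk_def by (intro generator_in_affine_semigroup) (auto simp: progression_def)
    then show ?thesis by (simp add: semigroup_ring_def)
  qed
  fix p q :: "'k mpoly"
  assume p: "p \<in> carrier (poly_ring (k + 1))"
  have mult: "x * y \<in> carrier ?T" if "x \<in> carrier ?T" "y \<in> carrier ?T" for x y
    using S.m_closed[OF that] by (simp add: semigroup_ring_def)
  show "phi a d p \<in> carrier ?T"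
    unfolding phi_def subst_hom_def
  proof (intro sum mult const prod pow gen)
    fix m i
    assume "m \<in> Poly_Mapping.keys p" "i \<in> Poly_Mapping.keys m"
    then show "i \<in> {1..k + 1}"
      using p unfolding poly_ring_def semigroup_ring_def by force
  qed
qed (simp_all add: poly_ring_def semigroup_ring_def phi_def subst_hom_add subst_hom_mult)

end

theory Submission
  imports Defs
begin

text \<open>
  All the generators are quadrics \<open>x\<^sub>p x\<^sub>q - x\<^sub>r x\<^sub>s\<close> with \<open>2 \<le> p \<le> q \<le> k\<close> and \<open>p + q = r + s\<close>, where
  \<open>r = 1\<close> or \<open>s = k + 1\<close>: a product of two inner variables is traded for a product that involves
  an endpoint variable. These are equations of the rational normal curve, and the
  semigroup ring of \<open>S\<^bsub>a,d,k\<^esub>\<close> is its homogeneous coordinate ring.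

  Generation. The monomial with exponent \<open>m\<close> is sent to \<open>t\<close> with exponent \<open>N a + W d\<close>, where \<open>N\<close> is
  its degree and \<open>W\<close> is the sum of \<open>(i - 1) m\<^sub>i\<close>. By linear independence the image determines
  \<open>(N, W)\<close>, so a polynomial in the kernel has coefficients that sum to zero over each set of
  monomials sharing \<open>(N, W)\<close>. It thus suffices that two monomials with the same \<open>(N, W)\<close> agree
  modulo the quadrics (\<open>mono_cong_if_degrees_eq\<close>). Rewriting with the quadrics preserves \<open>(N, W)\<close>
  and lowers the number of inner variables, until at most one is left (\<open>mono_cong_reduced\<close>).
  Such a reduced monomial \<open>x\<^sub>1\<^sup>\<alpha> x\<^sub>j\<^sup>\<epsilon> x\<^bsub>k+1\<^esub>\<^sup>\<beta>\<close> is recovered from \<open>(N, W)\<close> by division with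
  remainder of \<open>W\<close> by \<open>k\<close> (\<open>lookup_reduced\<close>).

  Minimality. The product \<open>x\<^sub>p x\<^sub>q\<close> of inner variables occurs in exactly one of the quadrics. As all
  the quadrics are homogeneous of degree two, the others lie in the ideal spanned by the monomials that do
  not divide \<open>x\<^sub>p x\<^sub>q\<close>, and the quadric with leading term \<open>x\<^sub>p x\<^sub>q\<close> does not (\<open>quadric_irredundant\<close>).
\<close>

section \<open>The generators\<close>

text \<open>The exponent of the product of two variables that has the same index sum as \<open>x\<^sub>p x\<^sub>q\<close> and
  contains \<open>x\<^sub>1\<close> or \<open>x\<^bsub>k+1\<^esub>\<close>. Both choices are possible only for \<open>p + q = k + 2\<close>, where they agree;
  this is why the different case distinctions in \<^const>\<open>xi\<close> reduce to this one.\<close>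

definition endpoint_exp :: "nat \<Rightarrow> nat \<Rightarrow> nat \<Rightarrow> (nat \<Rightarrow>\<^sub>0 nat)" where
  "endpoint_exp k p q =
     (if p + q \<le> k + 2 then Poly_Mapping.single 1 1 + Poly_Mapping.single (p + q - 1) 1
      else Poly_Mapping.single (p + q - (k + 1)) 1 + Poly_Mapping.single (k + 1) 1)"

definition quadric :: "nat \<Rightarrow> nat \<Rightarrow> nat \<Rightarrow> 'k::field mpoly" where
  "quadric k p q =
     Poly_Mapping.single (Poly_Mapping.single p 1 + Poly_Mapping.single q 1) 1
     - Poly_Mapping.single (endpoint_exp k p q) 1"

lemma x_var_mult:
  "x_var i * x_var j = Poly_Mapping.single (Poly_Mapping.single i 1 + Poly_Mapping.single j 1) 1"
  by (simp add: x_var_def mult_single)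

text \<open>With \<open>q = l + i\<close>, the three families in \<^const>\<open>xi\<close> are separated by the sign of
  \<open>l + q - (k + 2)\<close>. When \<open>2 * l > k + 1\<close>, the sum \<open>l + q\<close> is at least \<open>k + 2\<close>, with equality only
  for \<open>i = 0\<close>, and there the two forms of the endpoint product coincide.\<close>

lemma xi_eq_quadrics:
  assumes "2 \<le> l" "l \<le> k"
  shows "xi k l = {quadric k l q | q. l \<le> q \<and> q \<le> k}"
proof -
  have q: "quadric k l q = (if l + q \<le> k + 2 then x_var l * x_var q - x_var 1 * x_var (l + q - 1)
      else x_var l * x_var q - x_var (l + q - (k + 1)) * x_var (k + 1))" for q
    by (simp add: quadric_def endpoint_exp_def x_var_mult)
  have shift: "{quadric k l q | q. l \<le> q \<and> q \<le> k}
      = insert (quadric k l l) {quadric k l (l + i) | i. 1 \<le> i \<and> i \<le> k - l}" (is "?L = ?R")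
  proof (intro equalityI subsetI)
    fix x assume "x \<in> ?L"
    then obtain r where r: "x = quadric k l r" "l \<le> r" "r \<le> k" by blast
    show "x \<in> ?R"
    proof (cases "r = l")
      case False
      then have "x = quadric k l (l + (r - l)) \<and> 1 \<le> r - l \<and> r - l \<le> k - l"
        using r by auto
      then show ?thesis by blast
    qed (use r in simp)
  next
    fix x assume "x \<in> ?R"
    then show "x \<in> ?L"
    proof
      assume "x \<in> {quadric k l (l + i) | i. 1 \<le> i \<and> i \<le> k - l}"
      then obtain i where "x = quadric k l (l + i)" "i \<le> k - l" by blast
      then show ?thesis using assms by (intro CollectI exI[of _ "l + i"]) auto
    qed (use assms in auto)
  qed
  show ?thesis
  proof (cases "2 * l > k + 1")
    case True
    have a: "quadric k l (l + i) = x_var l * x_var (l + i) - x_var (2 * l + i - (k + 1)) * x_var (k + 1)"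
      for i :: nat
    proof (cases "l + (l + i) \<le> k + 2")
      case c: True
      then have "i = 0" "l + l = k + 2" using True by auto
      then show ?thesis unfolding q by (simp add: mult_2)
    next
      case False
      have e: "l + (l + i) = 2 * l + i" by simp
      show ?thesis using False unfolding q e by simp
    qed
    have b: "quadric k l l = x_var l ^ 2 - x_var (2 * l - (k + 1)) * x_var (k + 1)"
      using a[of 0] by (simp add: power2_eq_square)
    show ?thesis
      unfolding shift unfolding a b xi_def using True by simp
  next
    case False
    have b: "quadric k l l = x_var l ^ 2 - x_var 1 * x_var (2 * l - 1)"
      unfolding q using False by (simp add: power2_eq_square mult_2)
    have le: "i \<le> k - l" if "i \<le> k + 2 - 2 * l" for i using that assms False by arith
    have c: "quadric k l (l + i) = x_var l * x_var (l + i) - x_var 1 * x_var (2 * l - 1 + i)"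
      if "i \<le> k + 2 - 2 * l" for i
    proof -
      have "l + (l + i) \<le> k + 2" "l + (l + i) - 1 = 2 * l - 1 + i"
        using that False assms by arith+
      then show ?thesis unfolding q by simp
    qed
    have e: "quadric k l (l + i) = x_var l * x_var (l + i) - x_var (2 * l + i - (k + 1)) * x_var (k + 1)"
      if "k + 2 - 2 * l < i" for i
    proof -
      have f: "l + (l + i) = 2 * l + i" by simp
      have "\<not> 2 * l + i \<le> k + 2" using that by arith
      then show ?thesis unfolding q f by simp
    qed
    have split: "{quadric k l (l + i) | i. 1 \<le> i \<and> i \<le> k - l}
       = {quadric k l (l + i) | i. 1 \<le> i \<and> i \<le> k + 2 - 2 * l}
         \<union> {quadric k l (l + i) | i. k + 2 - 2 * l < i \<and> i \<le> k - l}"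
      using le False by (auto simp: not_le) (metis not_le)+
    have s1: "{quadric k l (l + i) | i. 1 \<le> i \<and> i \<le> k + 2 - 2 * l}
       = {x_var l * x_var (l + i) - x_var 1 * x_var (2 * l - 1 + i) | i. 1 \<le> i \<and> i \<le> k + 2 - 2 * l}"
      unfolding setcompr_eq_image using c by (intro image_cong) auto
    have s2: "{quadric k l (l + i) | i. k + 2 - 2 * l < i \<and> i \<le> k - l}
       = {x_var l * x_var (l + i) - x_var (2 * l + i - (k + 1)) * x_var (k + 1) | i.
           k + 2 - 2 * l < i \<and> i \<le> k - l}"
      unfolding setcompr_eq_image using e by (intro image_cong) auto
    show ?thesis
      unfolding shift split s1 s2 b xi_def using False by auto
  qed
qed

lemma Union_xi_eq_quadrics:
  "(\<Union>l\<in>{2..k}. xi k l) = {quadric k p q | p q. 2 \<le> p \<and> p \<le> q \<and> q \<le> k}"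
proof -
  have "(\<Union>l\<in>{2..k}. xi k l) = (\<Union>l\<in>{2..k}. {quadric k l q | q. l \<le> q \<and> q \<le> k})"
    by (intro SUP_cong refl xi_eq_quadrics) auto
  also have "\<dots> = {quadric k p q | p q. 2 \<le> p \<and> p \<le> q \<and> q \<le> k}"
    by fastforce
  finally show ?thesis .
qed

section \<open>Additive statistics of exponents\<close>

text \<open>Degree, exponent of \<open>d\<close> and number of inner variables are treated uniformly as weighted sums of
  the exponents. Summing over \<open>{1..k + 1}\<close> instead of the support makes additivity immediate.\<close>

definition weighted_degree :: "nat \<Rightarrow> (nat \<Rightarrow> nat) \<Rightarrow> (nat \<Rightarrow>\<^sub>0 nat) \<Rightarrow> nat" where
  "weighted_degree k w m = (\<Sum>i\<in>{1..k + 1}. w i * Poly_Mapping.lookup m i)"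

abbreviation total_degree :: "nat \<Rightarrow> (nat \<Rightarrow>\<^sub>0 nat) \<Rightarrow> nat" where
  "total_degree k \<equiv> weighted_degree k (\<lambda>_. 1)"

abbreviation step_degree :: "nat \<Rightarrow> (nat \<Rightarrow>\<^sub>0 nat) \<Rightarrow> nat" where
  "step_degree k \<equiv> weighted_degree k (\<lambda>i. i - 1)"

abbreviation inner_degree :: "nat \<Rightarrow> (nat \<Rightarrow>\<^sub>0 nat) \<Rightarrow> nat" where
  "inner_degree k \<equiv> weighted_degree k (\<lambda>i. if i \<in> {2..k} then 1 else 0)"

lemma weighted_degree_add [simp]:
  "weighted_degree k w (m + m') = weighted_degree k w m + weighted_degree k w m'"
  by (simp add: weighted_degree_def lookup_add distrib_left sum.distrib)

lemma weighted_degree_single [simp]: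
  "weighted_degree k w (Poly_Mapping.single i c) = (if i \<in> {1..k + 1} then w i * c else 0)"
proof -
  have "weighted_degree k w (Poly_Mapping.single i c)
      = (\<Sum>j\<in>{1..k + 1}. if j = i then w i * c else 0)"
    unfolding weighted_degree_def by (intro sum.cong) (auto simp: lookup_single when_def)
  then show ?thesis by simp
qed

text \<open>Replacing \<open>x\<^sub>p x\<^sub>q\<close> by the endpoint product keeps the two statistics seen by the monomial map and
  strictly lowers the third, which makes the rewriting terminate.\<close>

lemma endpoint_exp_degrees:
  assumes "2 \<le> p" "p \<le> q" "q \<le> k"
  shows "Poly_Mapping.keys (endpoint_exp k p q) \<subseteq> {1..k + 1}"
    and "total_degree k (endpoint_exp k p q) = 2"
    and "step_degree k (endpoint_exp k p q) = (p - 1) + (q - 1)"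
    and "inner_degree k (endpoint_exp k p q) < 2"
proof -
  show "Poly_Mapping.keys (endpoint_exp k p q) \<subseteq> {1..k + 1}"
    unfolding endpoint_exp_def using assms
    by (auto dest!: Poly_Mapping.keys_add[THEN subsetD])
qed (use assms in \<open>auto simp: endpoint_exp_def simp del: One_nat_def\<close>)

section \<open>The monomial map\<close>

lemma single_power:
  fixes v :: "nat ^ 'r"
  shows "(Poly_Mapping.single v (1 :: 'k::field)) ^ e = Poly_Mapping.single (e *s v) 1"
proof (induction e)
  case 0
  have "0 *s v = 0" by (simp add: vec_eq_iff)
  then show ?case by simp
next
  case (Suc e)
  have "v + e *s v = Suc e *s v" by (simp add: vec_eq_iff)
  then show ?case using Suc by (simp add: mult_single)
qed

lemma prod_single:
  "(\<Prod>i\<in>A. Poly_Mapping.single (v i) (1 :: 'k::field)) = Poly_Mapping.single (\<Sum>i\<in>A. v i) 1"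
  by (induction A rule: infinite_finite_induct) (auto simp: mult_single)

lemma phi_single:
  fixes a d :: "nat ^ 'r"
  assumes "Poly_Mapping.keys m \<subseteq> {1..k + 1}"
  shows "phi a d (Poly_Mapping.single m (c :: 'k::field)) =
    Poly_Mapping.single (total_degree k m *s a + step_degree k m *s d) c"
proof -
  let ?e = "Poly_Mapping.lookup m"
  have "(\<Sum>i\<in>Poly_Mapping.keys m. ?e i *s (a + (i - 1) *s d))
      = (\<Sum>i\<in>{1..k + 1}. ?e i *s (a + (i - 1) *s d))"
    using assms by (intro sum.mono_neutral_left) (auto simp: in_keys_iff vec_eq_iff)
  also have "\<dots> = total_degree k m *s a + step_degree k m *s d"
    by (simp add: vec_eq_iff weighted_degree_def sum_distrib_left sum_distrib_right
        sum.distrib algebra_simps)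
  finally show ?thesis
    by (simp add: phi_def subst_hom_single single_power prod_single const_poly_def mult_single)
qed

text \<open>The hypothesis on \<open>a\<close> and \<open>d\<close> enters the proof here: the image of a
  monomial determines both its degree and its step degree.\<close>

lemma lin_indep_rat_coeffs_unique:
  fixes a d :: "nat ^ 'r"
  assumes "lin_indep_rat a d" and eq: "n *s a + w *s d = n' *s a + w' *s d"
  shows "n = n' \<and> w = w'"
proof -
  let ?c = "\<lambda>v. if v = rat_vec a then rat_of_nat n - rat_of_nat n' else rat_of_nat w - rat_of_nat w'"
  have "a \<noteq> d" and ind: "vec.independent {rat_vec a, rat_vec d}"
    using assms(1) by (auto simp: lin_indep_rat_def)
  then have ne: "rat_vec a \<noteq> rat_vec d"
    by (auto simp: rat_vec_def vec_eq_iff)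
  have "rat_of_nat (n * a $ i + w * d $ i) = rat_of_nat (n' * a $ i + w' * d $ i)" for i
    using eq by (simp add: vec_eq_iff)
  then have "(rat_of_nat n - rat_of_nat n') *s rat_vec a + (rat_of_nat w - rat_of_nat w') *s rat_vec d = 0"
    by (simp add: vec_eq_iff rat_vec_def algebra_simps)
  then have "(\<Sum>v\<in>{rat_vec a, rat_vec d}. ?c v *s v) = 0"
    using ne by simp
  then have "?c v = 0" if "v \<in> {rat_vec a, rat_vec d}" for v
    using vec.independentD[OF ind, of "{rat_vec a, rat_vec d}" ?c v] that by blast
  from this[of "rat_vec a"] this[of "rat_vec d"] show ?thesis
    using ne by auto
qed

lemma phi_add: "phi a d (p + q) = phi a d p + phi a d q"
  by (simp add: phi_def subst_hom_add)

section \<open>Ideals of the polynomial ring\<close>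

lemma poly_ring_simps:
  "carrier (poly_ring n) = {p. \<forall>m\<in>Poly_Mapping.keys p. Poly_Mapping.keys m \<subseteq> {1..n}}"
  "mult (poly_ring n) = (*)" "one (poly_ring n) = 1"
  "zero (poly_ring n) = 0" "add (poly_ring n) = (+)"
  by (auto simp: poly_ring_def semigroup_ring_def)

text \<open>The record-based ring has its additive inverse defined by a description; this links it to the
  subtraction of the type.\<close>

lemma poly_ring_a_inv:
  assumes "p \<in> carrier (poly_ring n :: 'k::field mpoly ring)"
  shows "a_inv (poly_ring n) p = - p"
proof -
  interpret cring "poly_ring n :: 'k mpoly ring" by (rule cring_poly_ring)
  show ?thesis
    using assms by (intro minus_equality) (auto simp: poly_ring_simps)
qed

text \<open>The ideal properties restated with the operations of the type, so that membership can be proved by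
  ordinary ring rewriting.\<close>

locale poly_ideal = ideal I "poly_ring n" for I :: "'k::field mpoly set" and n :: nat
begin

lemma zero_mem: "0 \<in> I"
  using additive_subgroup.zero_closed[OF is_additive_subgroup] by (simp add: poly_ring_simps)

lemma add_mem: "p \<in> I \<Longrightarrow> q \<in> I \<Longrightarrow> p + q \<in> I"
  using additive_subgroup.a_closed[OF is_additive_subgroup] by (simp add: poly_ring_simps)

lemma mult_mem: "p \<in> I \<Longrightarrow> q \<in> carrier (poly_ring n) \<Longrightarrow> q * p \<in> I"
  using I_l_closed by (simp add: poly_ring_simps)

lemma uminus_mem: "p \<in> I \<Longrightarrow> - p \<in> I"
  using mult_mem[of p "- 1"] by (simp add: poly_ring_simps)

lemma sum_mem: "(\<And>x. x \<in> A \<Longrightarrow> f x \<in> I) \<Longrightarrow> sum f A \<in> I"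
  by (induction A rule: infinite_finite_induct) (auto intro: zero_mem add_mem)

definition mono_cong :: "(nat \<Rightarrow>\<^sub>0 nat) \<Rightarrow> (nat \<Rightarrow>\<^sub>0 nat) \<Rightarrow> bool" where
  "mono_cong m m' \<longleftrightarrow> Poly_Mapping.single m 1 - Poly_Mapping.single m' 1 \<in> I"

lemma mono_cong_refl: "mono_cong m m"
  by (simp add: mono_cong_def zero_mem)

lemma mono_cong_sym: "mono_cong m m' \<Longrightarrow> mono_cong m' m"
  unfolding mono_cong_def by (drule uminus_mem) simp

lemma mono_cong_trans: "mono_cong m m' \<Longrightarrow> mono_cong m' m'' \<Longrightarrow> mono_cong m m''"
  unfolding mono_cong_def by (drule (1) add_mem) simp

lemma mono_cong_add:
  assumes "mono_cong m m'" "Poly_Mapping.keys u \<subseteq> {1..n}"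
  shows "mono_cong (u + m) (u + m')"
  using mult_mem[OF assms(1)[unfolded mono_cong_def], of "Poly_Mapping.single u 1"] assms(2)
  by (simp add: mono_cong_def poly_ring_simps right_diff_distrib mult_single)

end

section \<open>Reduction to a normal form\<close>

lemma split_off_inner_pair:
  assumes "inner_degree k m \<ge> 2"
  obtains p q u where "2 \<le> p" "p \<le> q" "q \<le> k"
    "m = u + (Poly_Mapping.single p 1 + Poly_Mapping.single q 1)"
proof -
  have split_one: "\<exists>i u. i \<in> {2..k} \<and> m = u + Poly_Mapping.single i 1"
    if pos: "inner_degree k m \<noteq> 0" for m
  proof -
    have "inner_degree k m = 0" if "\<And>i. i \<in> {2..k} \<Longrightarrow> Poly_Mapping.lookup m i = 0"
      unfolding weighted_degree_def using that by (intro sum.neutral) auto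
    then obtain i where i: "i \<in> {2..k}" "Poly_Mapping.lookup m i \<noteq> 0"
      using pos by blast
    have "m = (m - Poly_Mapping.single i 1) + Poly_Mapping.single i 1"
      using i by (intro poly_mapping_eqI) (auto simp: lookup_add lookup_minus lookup_single when_def)
    then show ?thesis using i by blast
  qed
  obtain i v where i: "i \<in> {2..k}" "m = v + Poly_Mapping.single i 1"
    using split_one[of m] assms by auto
  then have "inner_degree k v \<noteq> 0" using assms by (auto simp del: One_nat_def)
  then obtain j u where j: "j \<in> {2..k}" "v = u + Poly_Mapping.single j 1"
    using split_one[of v] by blast
  show thesis
  proof (cases "i \<le> j")
    case True
    then show ?thesis using that[of i j u] i j by (auto simp: add_ac)
  next
    case False
    then show ?thesis using that[of j i u] i j by (auto simp: add_ac)
  qed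
qed

text \<open>While two inner variables are left, one of the quadrics replaces them by an endpoint
  product; induction on the number of inner variables.\<close>

lemma (in poly_ideal) mono_cong_reduced:
  assumes n: "n = k + 1"
    and quadrics: "\<And>p q. 2 \<le> p \<Longrightarrow> p \<le> q \<Longrightarrow> q \<le> k \<Longrightarrow> quadric k p q \<in> I"
    and "Poly_Mapping.keys m \<subseteq> {1..k + 1}"
  obtains m' where "Poly_Mapping.keys m' \<subseteq> {1..k + 1}" "inner_degree k m' \<le> 1"
    "total_degree k m' = total_degree k m" "step_degree k m' = step_degree k m"
    "mono_cong m m'"
proof -
  have "\<exists>m'. Poly_Mapping.keys m' \<subseteq> {1..k + 1} \<and> inner_degree k m' \<le> 1 \<and>
      total_degree k m' = total_degree k m \<and> step_degree k m' = step_degree k m \<and> mono_cong m m'"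
    using assms(3)
  proof (induction "inner_degree k m" arbitrary: m rule: less_induct)
    case less
    show ?case
    proof (cases "inner_degree k m \<le> 1")
      case True
      then show ?thesis using less.prems mono_cong_refl by blast
    next
      case False
      then obtain p q u where pq: "2 \<le> p" "p \<le> q" "q \<le> k"
        and m: "m = u + (Poly_Mapping.single p 1 + Poly_Mapping.single q 1)"
        using split_off_inner_pair[of k m] by (metis Suc_1 not_less_eq_eq One_nat_def)
      have u: "Poly_Mapping.keys u \<subseteq> {1..k + 1}"
        using less.prems unfolding m by (auto simp: in_keys_iff lookup_add subset_iff)
      let ?m = "u + endpoint_exp k p q"
      note ep = endpoint_exp_degrees[OF pq]
      have keys: "Poly_Mapping.keys ?m \<subseteq> {1..k + 1}"
        using u ep(1) Poly_Mapping.keys_add[of u "endpoint_exp k p q"] by blast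
      have deg: "total_degree k ?m = total_degree k m" "step_degree k ?m = step_degree k m"
        using pq ep(2,3) unfolding m by (simp_all del: One_nat_def)
      have less: "inner_degree k ?m < inner_degree k m"
        using pq ep(4) unfolding m by (simp del: One_nat_def)
      have cong: "mono_cong m ?m"
        unfolding m using quadrics[OF pq] u n
        by (intro mono_cong_add) (auto simp: mono_cong_def quadric_def)
      obtain m' where m': "Poly_Mapping.keys m' \<subseteq> {1..k + 1}" "inner_degree k m' \<le> 1"
          "total_degree k m' = total_degree k ?m" "step_degree k m' = step_degree k ?m"
          "mono_cong ?m m'"
        using less.hyps[OF less keys] by blast
      show ?thesis
        using m' deg mono_cong_trans[OF cong m'(5)] by (intro exI[of _ m'] conjI) simp_all
    qed
  qed
  then show thesis using that by blast
qed

text \<open>In a reduced monomial the inner part contributes some \<open>r < k\<close> to the step degree, namely \<open>0\<close> if it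
  is trivial and \<open>j - 1\<close> if it is \<open>x\<^sub>j\<close>, while each \<open>x\<^bsub>k+1\<^esub>\<close> contributes \<open>k\<close>. Hence quotient and
  remainder of \<open>W\<close> by \<open>k\<close> give the exponents of \<open>x\<^bsub>k+1\<^esub>\<close> and of the inner variables, and the degree
  gives that of \<open>x\<^sub>1\<close>.\<close>

lemma lookup_reduced:
  assumes k: "k \<ge> 2" and inner: "inner_degree k m \<le> 1"
  defines "N \<equiv> total_degree k m" and "W \<equiv> step_degree k m"
  shows "Poly_Mapping.lookup m (k + 1) = W div k"
    and "i \<in> {2..k} \<Longrightarrow> Poly_Mapping.lookup m i = (if W mod k = i - 1 then 1 else 0)"
    and "Poly_Mapping.lookup m 1 = N - W div k - (if W mod k = 0 then 0 else 1)"
proof -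
  let ?e = "Poly_Mapping.lookup m"
  have range: "{1..k + 1} = insert 1 (insert (k + 1) {2..k})" using k by auto
  have N: "N = ?e 1 + ?e (k + 1) + (\<Sum>i\<in>{2..k}. ?e i)"
    unfolding N_def weighted_degree_def range using k by simp
  have W: "W = k * ?e (k + 1) + (\<Sum>i\<in>{2..k}. (i - 1) * ?e i)"
    unfolding W_def weighted_degree_def range using k by simp
  have "(\<Sum>i\<in>{2..k}. ?e i) \<le> 1"
    using inner unfolding weighted_degree_def range using k by simp
  then consider "(\<Sum>i\<in>{2..k}. ?e i) = 0" | "(\<Sum>i\<in>{2..k}. ?e i) = 1" by linarith
  \<comment> \<open>\<open>r = 0\<close> codes the absence of inner variables, since an inner \<open>x\<^sub>j\<close> has \<open>j - 1 > 0\<close>.\<close>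
  then obtain r where r: "r < k" "\<And>i. i \<in> {2..k} \<Longrightarrow> ?e i = (if r = i - 1 then 1 else 0)"
    and sum: "(\<Sum>i\<in>{2..k}. ?e i) = (if r = 0 then 0 else 1)"
      "(\<Sum>i\<in>{2..k}. (i - 1) * ?e i) = r"
  proof cases
    case 1
    then show thesis using that[of 0] k by auto
  next
    case 2
    then have "\<exists>j\<in>{2..k}. ?e j = 1 \<and> (\<forall>i\<in>{2..k}. j \<noteq> i \<longrightarrow> ?e i = 0)"
      by (subst (asm) sum_eq_1_iff) simp_all
    then obtain j where j: "j \<in> {2..k}" "?e j = 1" "\<forall>i\<in>{2..k}. j \<noteq> i \<longrightarrow> ?e i = 0"
      by (elim bexE conjE)
    have "(\<Sum>i\<in>{2..k}. (i - 1) * ?e i) = (\<Sum>i\<in>{2..k}. if i = j then j - 1 else 0)"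
      using j by (intro sum.cong) auto
    then have "(\<Sum>i\<in>{2..k}. (i - 1) * ?e i) = j - 1" using j(1) by simp
    moreover have "?e i = (if j - 1 = i - 1 then 1 else 0)" if i: "i \<in> {2..k}" for i
    proof (cases "i = j")
      case False
      then have "j - 1 \<noteq> i - 1" using i j(1) by auto
      then show ?thesis using False j(3) i by auto
    qed (use j(2) in simp)
    moreover have "j - 1 < k" "j - 1 \<noteq> 0" using j(1) by auto
    ultimately show thesis using that[of "j - 1"] 2 by presburger
  qed
  have "W div k = ?e (k + 1)" "W mod k = r"
    using W sum(2) r(1) by simp_all
  then show "?e (k + 1) = W div k"
    and "i \<in> {2..k} \<Longrightarrow> ?e i = (if W mod k = i - 1 then 1 else 0)"
    and "?e 1 = N - W div k - (if W mod k = 0 then 0 else 1)"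
    using r(2) N sum(1) by auto
qed

lemma reduced_unique:
  assumes "k \<ge> 2"
    and "Poly_Mapping.keys m \<subseteq> {1..k + 1}" "Poly_Mapping.keys m' \<subseteq> {1..k + 1}"
    and "inner_degree k m \<le> 1" "inner_degree k m' \<le> 1"
    and "total_degree k m = total_degree k m'" "step_degree k m = step_degree k m'"
  shows "m = m'"
proof (rule poly_mapping_eqI)
  fix i
  consider "i = 1" | "i \<in> {2..k}" | "i = k + 1" | "i \<notin> {1..k + 1}" by fastforce
  then show "Poly_Mapping.lookup m i = Poly_Mapping.lookup m' i"
  proof cases
    case 4
    then have "i \<notin> Poly_Mapping.keys m" "i \<notin> Poly_Mapping.keys m'"
      using assms(2,3) by blast+
    then show ?thesis by (simp add: in_keys_iff)
  qed (simp_all only: lookup_reduced[OF assms(1,4)] lookup_reduced[OF assms(1,5)] assms(6,7))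
qed

section \<open>Generation and minimality\<close>

text \<open>Both monomials reduce to the same normal form. This is the binomial part of the generation
  statement.\<close>

lemma (in poly_ideal) mono_cong_if_degrees_eq:
  assumes "k \<ge> 2" and "n = k + 1"
    and "\<And>p q. 2 \<le> p \<Longrightarrow> p \<le> q \<Longrightarrow> q \<le> k \<Longrightarrow> quadric k p q \<in> I"
    and "Poly_Mapping.keys m \<subseteq> {1..k + 1}" "Poly_Mapping.keys m' \<subseteq> {1..k + 1}"
    and "total_degree k m = total_degree k m'" "step_degree k m = step_degree k m'"
  shows "mono_cong m m'"
proof -
  obtain r where r: "Poly_Mapping.keys r \<subseteq> {1..k + 1}" "inner_degree k r \<le> 1"
    "total_degree k r = total_degree k m" "step_degree k r = step_degree k m" "mono_cong m r"
    using mono_cong_reduced[OF assms(2,3,4)] by blast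
  obtain r' where r': "Poly_Mapping.keys r' \<subseteq> {1..k + 1}" "inner_degree k r' \<le> 1"
    "total_degree k r' = total_degree k m'" "step_degree k r' = step_degree k m'" "mono_cong m' r'"
    using mono_cong_reduced[OF assms(2,3,5)] by blast
  have "r = r'"
    using reduced_unique[OF assms(1) r(1) r'(1) r(2) r'(2)] r r' assms by simp
  then show ?thesis
    using r(5) r'(5) mono_cong_sym mono_cong_trans by blast
qed

text \<open>Passing from binomials to arbitrary kernel elements: replacing each monomial of \<open>f\<close> by a chosen
  representative of its fibre changes \<open>f\<close> by an element of the ideal, and the result is zero because the
  coefficients on a fibre cancel.\<close>

lemma (in poly_ideal) mem_if_fibre_sums_zero:
  fixes v :: "(nat \<Rightarrow>\<^sub>0 nat) \<Rightarrow> 'b"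
  assumes zero: "\<And>s. (\<Sum>m\<in>{m \<in> Poly_Mapping.keys f. v m = s}. Poly_Mapping.lookup f m) = 0"
    and fibre: "\<And>m m'. m \<in> Poly_Mapping.keys f \<Longrightarrow> m' \<in> Poly_Mapping.keys f \<Longrightarrow> v m = v m' \<Longrightarrow>
      mono_cong m m'"
  shows "f \<in> I"
proof -
  let ?K = "Poly_Mapping.keys f" and ?c = "Poly_Mapping.lookup f"
  define rep where "rep s = (SOME m. m \<in> ?K \<and> v m = s)" for s
  have rep: "rep (v m) \<in> ?K \<and> v (rep (v m)) = v m" if "m \<in> ?K" for m
    unfolding rep_def by (rule someI[of _ m]) (use that in simp)
  have "(\<Sum>m\<in>?K. Poly_Mapping.single (rep (v m)) (?c m)) =
      (\<Sum>s\<in>v ` ?K. \<Sum>m\<in>{m \<in> ?K. v m = s}. Poly_Mapping.single (rep (v m)) (?c m))"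
    by (rule sum.image_gen) simp
  also have "\<dots> = (\<Sum>s\<in>v ` ?K. Poly_Mapping.single (rep s) (\<Sum>m\<in>{m \<in> ?K. v m = s}. ?c m))"
  proof (rule sum.cong[OF refl])
    fix s
    have "(\<Sum>m\<in>A. Poly_Mapping.single (rep s) (?c m)) = Poly_Mapping.single (rep s) (\<Sum>m\<in>A. ?c m)"
      for A by (induction A rule: infinite_finite_induct) (simp_all add: single_add)
    then show "(\<Sum>m\<in>{m \<in> ?K. v m = s}. Poly_Mapping.single (rep (v m)) (?c m)) =
        Poly_Mapping.single (rep s) (\<Sum>m\<in>{m \<in> ?K. v m = s}. ?c m)"
      by simp
  qed
  also have "\<dots> = 0" by (simp add: zero)
  finally have "f = (\<Sum>m\<in>?K. Poly_Mapping.single m (?c m) - Poly_Mapping.single (rep (v m)) (?c m))"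
    by (simp add: sum_subtractf sum_monomials)
  also have "\<dots> \<in> I"
  proof (rule sum_mem)
    fix m assume m: "m \<in> ?K"
    then have "mono_cong m (rep (v m))" using rep fibre by metis
    then have "const_poly (?c m) * (Poly_Mapping.single m 1 - Poly_Mapping.single (rep (v m)) 1) \<in> I"
      unfolding mono_cong_def by (rule mult_mem) (simp add: poly_ring_simps const_poly_def)
    then show "Poly_Mapping.single m (?c m) - Poly_Mapping.single (rep (v m)) (?c m) \<in> I"
      by (simp add: const_poly_def right_diff_distrib mult_single)
  qed
  finally show ?thesis .
qed

lemma mem_defining_ideal_iff:
  "f \<in> defining_ideal a d k \<longleftrightarrow> f \<in> carrier (poly_ring (k + 1)) \<and> phi a d f = 0"
  by (simp add: defining_ideal_def a_kernel_def' semigroup_ring_def)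

lemma ideal_defining_ideal:
  fixes a d :: "nat ^ 'r"
  shows "ideal (defining_ideal a d k :: 'k::field mpoly set) (poly_ring (k + 1))"
proof -
  interpret ring_hom_ring "poly_ring (k + 1) :: 'k mpoly ring" "semigroup_ring (S_adk a d k)" "phi a d"
    by (intro ring_hom_ringI2 phi_in_ring_hom cring.axioms(1) cring_poly_ring cring_semigroup_ring_S_adk)
  show ?thesis unfolding defining_ideal_def by (rule kernel_is_ideal)
qed

lemma quadric_mem_defining_ideal:
  assumes "2 \<le> p" "p \<le> q" "q \<le> k"
  shows "(quadric k p q :: 'k::field mpoly) \<in> defining_ideal a d k"
proof -
  let ?m = "Poly_Mapping.single p 1 + Poly_Mapping.single q 1 :: nat \<Rightarrow>\<^sub>0 nat"
  let ?e = "endpoint_exp k p q"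
  have keys: "Poly_Mapping.keys ?m \<subseteq> {1..k + 1}"
    using assms by (auto dest!: Poly_Mapping.keys_add[THEN subsetD])
  have deg: "total_degree k ?m = 2" "step_degree k ?m = (p - 1) + (q - 1)"
    using assms by (simp_all del: One_nat_def)
  note ep = endpoint_exp_degrees[OF assms]
  have "quadric k p q = Poly_Mapping.single ?m (1 :: 'k) + Poly_Mapping.single ?e (- 1)"
    by (simp add: quadric_def single_uminus)
  then have "phi a d (quadric k p q :: 'k mpoly) = 0"
    using phi_single[OF keys, of a d "1 :: 'k"] phi_single[OF ep(1), of a d "- 1 :: 'k"]
    unfolding deg ep(2,3) by (simp only: phi_add flip: single_add) simp
  moreover have "(quadric k p q :: 'k mpoly) \<in> carrier (poly_ring (k + 1))"
    using keys ep(1) keys_diff[of "Poly_Mapping.single ?m (1 :: 'k)" "Poly_Mapping.single ?e 1"]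
    by (auto simp: poly_ring_simps quadric_def)
  ultimately show ?thesis by (simp add: mem_defining_ideal_iff)
qed

text \<open>The coefficient of \<open>t\<close> with exponent \<open>s\<close> in the image of \<open>f\<close> is the sum of the coefficients of \<open>f\<close> over the
  fibre of \<open>s\<close>, so these fibre sums vanish on the kernel.\<close>

lemma (in poly_ideal) defining_ideal_subset:
  fixes a d :: "nat ^ 'r"
  assumes "k \<ge> 2" and ind: "lin_indep_rat a d" and "n = k + 1"
    and quadrics: "\<And>p q. 2 \<le> p \<Longrightarrow> p \<le> q \<Longrightarrow> q \<le> k \<Longrightarrow> quadric k p q \<in> I"
  shows "defining_ideal a d k \<subseteq> I"
proof
  fix f :: "'k mpoly"
  assume "f \<in> defining_ideal a d k"
  then have keys: "\<And>m. m \<in> Poly_Mapping.keys f \<Longrightarrow> Poly_Mapping.keys m \<subseteq> {1..k + 1}"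
    and zero: "phi a d f = 0"
    by (auto simp: mem_defining_ideal_iff poly_ring_simps)
  define v where "v m = total_degree k m *s a + step_degree k m *s d" for m
  have "phi a d f = (\<Sum>m\<in>Poly_Mapping.keys f. phi a d (Poly_Mapping.single m (Poly_Mapping.lookup f m)))"
    unfolding phi_def subst_hom_sum[symmetric] sum_monomials ..
  also have "\<dots> = (\<Sum>m\<in>Poly_Mapping.keys f. Poly_Mapping.single (v m) (Poly_Mapping.lookup f m))"
    unfolding v_def using keys by (intro sum.cong refl phi_single)
  finally have phi: "phi a d f = \<dots>" .
  show "f \<in> I"
  proof (rule mem_if_fibre_sums_zero[of f v])
    fix s
    have "(\<Sum>m\<in>{m \<in> Poly_Mapping.keys f. v m = s}. Poly_Mapping.lookup f m)
        = Poly_Mapping.lookup (phi a d f) s"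
      unfolding phi by (simp add: lookup_sum lookup_single when_def sum.If_cases Int_def)
    then show "(\<Sum>m\<in>{m \<in> Poly_Mapping.keys f. v m = s}. Poly_Mapping.lookup f m) = 0"
      by (simp add: zero)
  next
    fix m m'
    assume "m \<in> Poly_Mapping.keys f" "m' \<in> Poly_Mapping.keys f" "v m = v m'"
    then show "mono_cong m m'"
      using lin_indep_rat_coeffs_unique[OF ind] keys
      by (intro mono_cong_if_degrees_eq[OF assms(1,3) quadrics]) (auto simp: v_def)
  qed
qed

text \<open>A multiple of a non-divisor of a monomial is again a non-divisor, so the polynomials without
  any term dividing a fixed monomial \<open>u\<close> form an ideal. It is used to separate one generator from the
  others.\<close>

lemma ideal_avoiding_divisors:
  "ideal {f \<in> carrier (poly_ring n :: 'k::field mpoly ring). \<forall>m\<in>Poly_Mapping.keys f. \<forall>m'. m + m' \<noteq> u}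
     (poly_ring n)" (is "ideal ?J ?R")
proof -
  interpret cring ?R by (rule cring_poly_ring)
  have mult: "q * p \<in> ?J" if "p \<in> ?J" "q \<in> carrier ?R" for p q
  proof -
    have "q * p \<in> carrier ?R" using m_closed[of q p] that by (simp add: poly_ring_simps)
    moreover have "m + m' \<noteq> u" if m: "m \<in> Poly_Mapping.keys (q * p)" for m m'
    proof -
      obtain x y where "y \<in> Poly_Mapping.keys p" "m = x + y"
        using m keys_mult[of q p] by blast
      then have "m + m' = y + (x + m')" by (simp add: add_ac)
      then show ?thesis using \<open>p \<in> ?J\<close> \<open>y \<in> Poly_Mapping.keys p\<close> by auto
    qed
    ultimately show ?thesis by blast
  qed
  show ?thesis
  proof (rule idealI)
    show "ring ?R" by (rule ring_axioms)
    show "subgroup ?J (add_monoid ?R)"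
    proof (rule group.subgroupI)
      show "group (add_monoid ?R)" by (rule a_group)
      show "?J \<noteq> {}" by (auto simp: poly_ring_simps intro!: exI[of _ 0])
    next
      fix p assume "p \<in> ?J"
      then show "inv\<^bsub>add_monoid ?R\<^esub> p \<in> ?J"
        using poly_ring_a_inv[of p n] unfolding a_inv_def by (auto simp: poly_ring_simps)
    next
      fix p q assume "p \<in> ?J" "q \<in> ?J"
      then show "p \<otimes>\<^bsub>add_monoid ?R\<^esub> q \<in> ?J"
        using Poly_Mapping.keys_add[of p q] by (simp add: poly_ring_simps) blast
    qed auto
    fix p q assume "p \<in> ?J" "q \<in> carrier ?R"
    then show "q \<otimes>\<^bsub>?R\<^esub> p \<in> ?J" "p \<otimes>\<^bsub>?R\<^esub> q \<in> ?J"
      using mult[of p q] by (simp_all add: poly_ring_simps(2) mult.commute)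
  qed
qed

text \<open>Take \<open>u = x\<^sub>p x\<^sub>q\<close> in the preceding ideal. A term of degree two divides \<open>u\<close> only if it equals \<open>u\<close>;
  endpoint products contain \<open>x\<^sub>1\<close> or \<open>x\<^bsub>k+1\<^esub>\<close>, and the leading products of the other quadrics differ
  from \<open>u\<close> as unordered pairs of indices.\<close>

lemma quadric_irredundant:
  fixes H :: "'k::field mpoly set"
  assumes pq: "2 \<le> p" "p \<le> q" "q \<le> k"
    and H: "H \<subseteq> {quadric k p q | p q. 2 \<le> p \<and> p \<le> q \<and> q \<le> k} - {quadric k p q}"
  shows "quadric k p q \<notin> genideal (poly_ring (k + 1)) H"
proof -
  let ?u = "\<lambda>p q. Poly_Mapping.single p 1 + Poly_Mapping.single q 1 :: nat \<Rightarrow>\<^sub>0 nat"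
  let ?J = "{f \<in> carrier (poly_ring (k + 1) :: 'k mpoly ring).
    \<forall>m\<in>Poly_Mapping.keys f. \<forall>m'. m + m' \<noteq> ?u p q}"
  have endpoint: "?u p q \<noteq> endpoint_exp k p' q'" for p' q'
  proof
    assume "?u p q = endpoint_exp k p' q'"
    then have "Poly_Mapping.lookup (?u p q) 1 = Poly_Mapping.lookup (endpoint_exp k p' q') 1"
      and "Poly_Mapping.lookup (?u p q) (k + 1) = Poly_Mapping.lookup (endpoint_exp k p' q') (k + 1)"
      by simp_all
    then show False
      using pq by (auto simp: endpoint_exp_def lookup_add lookup_single when_def split: if_splits)
  qed
  have same_degree: "m = ?u p q" if "m + m' = ?u p q" "total_degree k m = 2" for m m'
  proof -
    have "m' = 0"
    proof (rule poly_mapping_eqI)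
      fix i
      have "total_degree k m + total_degree k m' = total_degree k (?u p q)"
        using that(1) by (metis weighted_degree_add)
      then have "total_degree k m' = 0"
        using that(2) pq by (simp del: One_nat_def)
      moreover have "Poly_Mapping.lookup m i + Poly_Mapping.lookup m' i
          = Poly_Mapping.lookup (?u p q) i"
        using that(1) by (metis lookup_add)
      ultimately show "Poly_Mapping.lookup m' i = Poly_Mapping.lookup 0 i"
        using pq by (cases "i \<in> {1..k + 1}")
          (auto simp: weighted_degree_def lookup_add lookup_single when_def split: if_splits)
    qed
    then show ?thesis using that(1) by simp
  qed
  have "H \<subseteq> ?J"
  proof
    fix h assume "h \<in> H"
    then obtain p' q' where pq': "2 \<le> p'" "p' \<le> q'" "q' \<le> k" and h: "h = quadric k p' q'"
      and ne: "(p', q') \<noteq> (p, q)"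
      using H by blast
    have "h \<in> carrier (poly_ring (k + 1))"
      using quadric_mem_defining_ideal[OF pq'] mem_defining_ideal_iff h by blast
    moreover have "m + m' \<noteq> ?u p q" if "m \<in> Poly_Mapping.keys h" for m m'
    proof
      assume eq: "m + m' = ?u p q"
      have m: "m = ?u p' q' \<or> m = endpoint_exp k p' q'"
        using that keys_diff[of "Poly_Mapping.single (?u p' q') (1 :: 'k)"
            "Poly_Mapping.single (endpoint_exp k p' q') 1"]
        by (auto simp: h quadric_def)
      then have "total_degree k m = 2"
        using endpoint_exp_degrees(2)[OF pq'] pq' by (auto simp del: One_nat_def)
      then have "m = ?u p q" by (rule same_degree[OF eq])
      then have u: "?u p q = ?u p' q'" using m endpoint by metis
      have "Poly_Mapping.keys (?u i j) = {i, j}" for i j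
        by (auto simp: in_keys_iff lookup_add lookup_single when_def split: if_splits)
      then have "{p, q} = {p', q'}" using u by metis
      then show False using ne pq(2) pq'(2) by (auto simp: doubleton_eq_iff)
    qed
    ultimately show "h \<in> ?J" by blast
  qed
  then have "genideal (poly_ring (k + 1)) H \<subseteq> ?J"
    using ideal_avoiding_divisors[of "k + 1" "?u p q"] by (auto simp: genideal_def)
  moreover have "?u p q \<in> Poly_Mapping.keys (quadric k p q :: 'k mpoly)"
    using endpoint[of p q] by (auto simp: quadric_def in_keys_iff lookup_minus lookup_single when_def)
  then have "quadric k p q \<notin> ?J" by (auto intro!: bexI[of _ "?u p q"] exI[of _ 0])
  ultimately show ?thesis by blast
qed

theorem theorem4p4:
  fixes a d :: "nat ^ 2" and k :: nat
  assumes "k \<ge> 2"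
    and "lin_indep_rat a d"
    and "minimal_generating_set affine_semigroup (S_adk a d k) (progression a d k)"
  shows "minimal_generating_set (genideal (poly_ring (k + 1)))
           (defining_ideal a d k :: 'k::field mpoly set) (\<Union>l\<in>{2..k}. xi k l)"
proof -
  let ?R = "poly_ring (k + 1) :: 'k mpoly ring"
  let ?D = "defining_ideal a d k :: 'k mpoly set"
  let ?G = "{quadric k p q | p q. 2 \<le> p \<and> p \<le> q \<and> q \<le> k} :: 'k mpoly set"
  have sub: "?G \<subseteq> ?D" using quadric_mem_defining_ideal by blast
  have "genideal ?R ?G = ?D"
  proof
    show "genideal ?R ?G \<subseteq> ?D"
      using sub ideal_defining_ideal[of a d k] by (auto simp: genideal_def)
    show "?D \<subseteq> genideal ?R ?G"
      unfolding genideal_def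
    proof (intro Inter_greatest, clarify)
      fix I f assume I: "ideal I ?R" "?G \<subseteq> I" and f: "f \<in> ?D"
      interpret poly_ideal I "k + 1" by (rule poly_ideal.intro) (rule I(1))
      show "f \<in> I"
        using defining_ideal_subset[OF assms(1,2) refl] I(2) f by blast
    qed
  qed
  moreover have "genideal ?R H \<noteq> ?D" if "H \<subset> ?G" for H
  proof -
    obtain g where "g \<in> ?G" "g \<notin> H" using \<open>H \<subset> ?G\<close> by blast
    then obtain p q where pq: "2 \<le> p" "p \<le> q" "q \<le> k" "quadric k p q \<notin> H" by blast
    then have "quadric k p q \<notin> genideal ?R H"
      using \<open>H \<subset> ?G\<close> by (intro quadric_irredundant) auto
    then show ?thesis using quadric_mem_defining_ideal[OF pq(1-3)] by metis
  qed
  ultimately show ?thesis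
    unfolding Union_xi_eq_quadrics minimal_generating_set_def using sub by blast
qed

end
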